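(* Let $T$ be a stopping time associated with the sequence $Z_1,Z_2,\dots$ of independent random variables, let $S_T:=Z_1+Z_2+\dots+Z_T$, and let $Y$ be a random variable such that $Y\cdot I_{[T=n]}$ is $\mathcal{F}_n$-measurable for every $n=1,2,\dots$. Then $$\mathbb{E}\left(Y e^{wS_T} I_{[T<\infty]}\right)=\tilde{\mathbb{E}}_w\left(Y\prod_{i=1}^{T}\mathbb{E}(e^{wZ_i})\, I_{[T<\infty]}\right)$$ for all real $w$ such that the expectations $\mathbb{E}\left(Y e^{wS_T} I_{[T<\infty]}\right)$ and $\tilde{\mathbb{E}}_w\left(Y\prod_{i=1}^{T}\mathbb{E}(e^{wZ_i})\, I_{[T<\infty]}\right)$ exist.
   Context: Let $F_1,F_2,\dots$ be probability distributions on $\mathbf{R}$ such that $\int_{\mathbf{R}} e^{wz}\,dF_i(z)<\infty$ for all $i\ge 1$ and all $w$ in an interval $\mathcal{W}$ containing $0$. Let $\Omega=\mathbf{R}^{\mathbf{N}}$, $\mathbf{N}=\{1,2,\dots\}$, let $Z_i:\Omega\to\mathbf{R}$, $Z_i(\mathbf{x})=x_i$, be the coordinate maps, and let $\mathcal{F}=\sigma(Z_1,Z_2,\dots)$. For $w\in\mathcal{W}$, let $F_i(\cdot|w)$ be the exponentially tilted distribution $$F_i(x|w)=\frac{\int_{(-\infty,x]}e^{wz}\,dF_i(z)}{\int_{\mathbf{R}}e^{wz}\,dF_i(z)},\quad x\in\mathbf{R},$$ and let $\tilde{\mathbb{P}}_w$ be the (product) probability measure on $(\Omega,\mathcal{F})$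 under which $Z_1,Z_2,\dots$ are independent with $Z_i\sim F_i(\cdot|w)$. Write $\mathbb{P}:=\tilde{\mathbb{P}}_0$ (so $Z_i\sim F_i$ under $\mathbb{P}$), $\tilde{\mathbb{E}}_w$ for expectation under $\tilde{\mathbb{P}}_w$, and $\mathbb{E}:=\tilde{\mathbb{E}}_0$. Let $\mathcal{F}_n=\sigma(Z_1,\dots,Z_n)$. A stopping time associated with $Z_1,Z_2,\dots$ is a map $T:\Omega\to\{1,2,\dots\}\cup\{\infty\}$ with $[T=n]=\{\omega:T(\omega)=n\}\in\mathcal{F}_n$ for every $n=1,2,\dots$. $I_A$ is the indicator of $A$; expressions multiplied by $I_{[T<\infty]}$ are taken to be $0$ on $[T=\infty]$. Real $w$ ranges over values for which $\tilde{\mathbb{P}}_w$ is defined ($w\in\mathcal{W}$), and an expectation "exists" when the integrand is (absolutely) integrable. *)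

theory Defs
  imports "HOL-Probability.Probability"
begin

(* A sequence (x_1, x_2, ...) is an element of PiM {1..}, i.e. a function nat => real that is
   constrained to be "undefined" at the unused index 0. *)

definition seq_borel :: "(nat \<Rightarrow> real) measure" where
  "seq_borel = PiM {1..} (\<lambda>_. borel)"

abbreviation \<Omega> :: "(nat \<Rightarrow> real) set" where
  "\<Omega> \<equiv> space seq_borel"

definition Z :: "nat \<Rightarrow> (nat \<Rightarrow> real) \<Rightarrow> real" where
  "Z i \<omega> = \<omega> i"

definition past :: "nat \<Rightarrow> (nat \<Rightarrow> real) measure" where
  "past n = sigma \<Omega> {Z i -` A \<inter> \<Omega> | i A. i \<in> {1..n} \<and> A \<in> sets borel}"

lemma sets_seq_borel:
  "sets seq_borel = sigma_sets \<Omega> {Z i -` A \<inter> \<Omega> | i A. i \<in> {1..} \<and> A \<in> sets borel}"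
proof -
  have "{Z i -` A \<inter> \<Omega> | i A. i \<in> {1..} \<and> A \<in> sets borel}
      = {{f \<in> \<Pi>\<^sub>E i\<in>{1..}. space borel. f i \<in> A} | i A. i \<in> {1..} \<and> A \<in> sets borel}"
    by (auto simp: seq_borel_def space_PiM Z_def vimage_def Int_def conj_commute)
  then show ?thesis
    unfolding seq_borel_def by (simp add: sets_PiM_single space_PiM)
qed

definition tilted_cdf :: "real measure \<Rightarrow> real \<Rightarrow> real \<Rightarrow> real" where
  "tilted_cdf M w x = (LINT z:{..x}|M. exp (w * z)) / (LINT z|M. exp (w * z))"

definition tilted :: "real measure \<Rightarrow> real \<Rightarrow> real measure" where
  "tilted M w = interval_measure (tilted_cdf M w)"

definition tilted_prob :: "(nat \<Rightarrow> real measure) \<Rightarrow> real \<Rightarrow> (nat \<Rightarrow> real) measure" where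
  "tilted_prob F w = PiM {1..} (\<lambda>i. tilted (F i) w)"

definition is_stopping_time :: "((nat \<Rightarrow> real) \<Rightarrow> enat) \<Rightarrow> bool" where
  "is_stopping_time T \<longleftrightarrow>
     (\<forall>\<omega>\<in>\<Omega>. 1 \<le> T \<omega>) \<and> (\<forall>n\<ge>1. {\<omega> \<in> \<Omega>. T \<omega> = enat n} \<in> sets (past n))"

(* The value on T = infinity is irrelevant: it only occurs multiplied by an indicator. *)
definition stopped_sum :: "((nat \<Rightarrow> real) \<Rightarrow> enat) \<Rightarrow> (nat \<Rightarrow> real) \<Rightarrow> real" where
  "stopped_sum T \<omega> = (\<Sum>i=1..the_enat (T \<omega>). Z i \<omega>)"

lemma sets_tilted_prob: "sets (tilted_prob F w) = sets seq_borel"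
  unfolding tilted_prob_def seq_borel_def by (rule sets_PiM_cong) (auto simp: tilted_def)

lemma tilted_eq_density:
  assumes M: "real_distribution M" and int: "integrable M (\<lambda>z. exp (w * z))"
  shows "real_distribution (tilted M w)"
    and "cdf (tilted M w) = tilted_cdf M w"
    and "tilted M w = density M (\<lambda>z. exp (w * z) / (LINT z|M. exp (w * z)))"
proof -
  interpret real_distribution M by fact
  let ?c = "LINT z|M. exp (w * z)"
  let ?D = "density M (\<lambda>z. ennreal (exp (w * z) / ?c))"
  have c: "?c > 0"
  proof -
    have "?c \<noteq> 0"
      using integral_nonneg_eq_0_iff_AE[OF int] by (simp add: AE_False)
    moreover have "?c \<ge> 0" by simp
    ultimately show ?thesis by linarith
  qed
  have E: "emeasure ?D A = ennreal ((LINT z:A|M. exp (w * z)) / ?c)" if "A \<in> sets borel" for A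
  proof -
    have "emeasure ?D A = (\<integral>\<^sup>+z. ennreal (indicator A z * exp (w * z) / ?c) \<partial>M)"
      using that by (subst emeasure_density) (auto intro!: nn_integral_cong split: split_indicator)
    also have "\<dots> = ennreal (LINT z|M. indicator A z * exp (w * z) / ?c)"
      using that c int by (intro nn_integral_eq_integral)
        (auto intro!: integrable_mult_indicator[where 'b=real, simplified] integrable_divide)
    finally show ?thesis by (simp add: set_lebesgue_integral_def)
  qed
  have rd: "real_distribution ?D"
  proof (intro real_distribution.intro prob_spaceI)
    show "emeasure ?D (space ?D) = 1"
      using E[of UNIV] c by (simp add: set_lebesgue_integral_def)
  qed (simp add: real_distribution_axioms_def)
  have cdf: "cdf ?D = tilted_cdf M w"
    using c E[OF atMost_borel]
    by (auto simp: fun_eq_iff cdf_def measure_def tilted_cdf_def set_lebesgue_integral_def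
             intro!: enn2real_ennreal divide_nonneg_pos integral_nonneg)
  interpret D: real_distribution ?D by (rule rd)
  have props: "\<And>x y. x \<le> y \<Longrightarrow> tilted_cdf M w x \<le> tilted_cdf M w y"
    "\<And>a. continuous (at_right a) (tilted_cdf M w)"
    "(tilted_cdf M w \<longlongrightarrow> 0) at_bot" "(tilted_cdf M w \<longlongrightarrow> 1) at_top"
    using D.cdf_nondecreasing D.cdf_is_right_cont D.cdf_lim_at_bot D.cdf_lim_at_top_prob
    by (simp_all add: cdf)
  show r: "real_distribution (tilted M w)"
    unfolding tilted_def by (rule real_distribution_interval_measure) (use props in auto)
  show q: "cdf (tilted M w) = tilted_cdf M w"
    unfolding tilted_def by (rule cdf_interval_measure) (use props in auto)
  show "tilted M w = ?D"
    by (rule cdf_unique[OF r rd]) (simp add: q cdf)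
qed

end

theory Submission
  imports Defs
begin

text \<open>
  This is Wald's likelihood ratio identity. Write \<open>c\<^sub>i\<close> for the mean of \<open>exp (w * Z i)\<close> under the
  untilted law. Tilting replaces the \<open>i\<close>-th marginal \<open>F i\<close> by the measure with density
  \<open>exp (w * z) / c\<^sub>i\<close> with respect to it. On all of \<open>\<Omega>\<close> the two product measures may well be mutually
  singular, since infinitely many marginals change. But an event that is decided by time \<open>n\<close> only
  involves the first \<open>n\<close> factors, and a finite product of measures with densities has as its density
  the product of the densities. So on \<open>past n\<close> the tilted law has the density
  \<open>exp (w * (Z 1 + \<dots> + Z n)) / (c\<^sub>1 * \<dots> * c\<^sub>n)\<close> with respect to the untilted one
  (\<open>emeasure_tilted_prob_past\<close>). Consequently, for a \<open>past n\<close>-measurable \<open>g\<close>, integrating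
  \<open>g * c\<^sub>1 * \<dots> * c\<^sub>n\<close> under the tilted law is the same as integrating \<open>g * exp (w * (Z 1 + \<dots> + Z n))\<close>
  under the untilted one (\<open>integral_tilted_prob_past\<close>).

  The stopped identity follows by cutting \<open>T < \<infinity>\<close> into the events \<open>T = n\<close>. On each of them \<open>T\<close> may be
  replaced by the constant \<open>n\<close>, and \<open>Y\<close> restricted to it is \<open>past n\<close>-measurable, so the preceding
  identity applies slice by slice. As \<open>Y\<close> has no sign, integrability of the two stopped integrands
  is what allows the integrals to be summed over the slices (\<open>integral_stopped_sums\<close>).
\<close>

section \<open>Densities of product measures\<close>

text \<open>
  A finite product measure is determined by its values on boxes, and on a box both the density and the
  indicator factor over the coordinates, so that the integral splits by Tonelli's theorem.
\<close>

lemma (in product_prob_space) PiM_density: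
  fixes f :: "'i \<Rightarrow> 'a \<Rightarrow> ennreal"
  assumes J: "finite J"
    and f [measurable]: "\<And>i. f i \<in> borel_measurable (M i)"
    and prob: "\<And>i. prob_space (density (M i) (f i))"
  shows "PiM J (\<lambda>i. density (M i) (f i)) = density (PiM J M) (\<lambda>x. \<Prod>i\<in>J. f i (x i))"
proof -
  interpret D: product_prob_space "\<lambda>i. density (M i) (f i)"
    by (rule product_prob_spaceI) (rule prob)
  have sets: "sets (PiM J (\<lambda>i. density (M i) (f i))) = sets (PiM J M)"
    by (rule sets_PiM_cong) auto
  show ?thesis
  proof (rule D.PiM_eqI[symmetric])
    fix A :: "'i \<Rightarrow> 'a set" assume "\<And>i. i \<in> J \<Longrightarrow> A i \<in> sets (density (M i) (f i))"
    then have A: "\<And>i. i \<in> J \<Longrightarrow> A i \<in> sets (M i)" by simp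
    have ind: "indicator (Pi\<^sub>E J A) x = (\<Prod>i\<in>J. indicator (A i) (x i) :: ennreal)"
      if "x \<in> space (PiM J M)" for x
      using that J by (auto simp: indicator_def space_PiM PiE_iff prod_zero_iff)
    have "emeasure (density (PiM J M) (\<lambda>x. \<Prod>i\<in>J. f i (x i))) (Pi\<^sub>E J A)
        = (\<integral>\<^sup>+x. (\<Prod>i\<in>J. f i (x i)) * indicator (Pi\<^sub>E J A) x \<partial>PiM J M)"
      using J A by (intro emeasure_density sets_PiM_I_finite) auto
    also have "\<dots> = (\<integral>\<^sup>+x. (\<Prod>i\<in>J. f i (x i) * indicator (A i) (x i)) \<partial>PiM J M)"
      by (intro nn_integral_cong) (simp add: ind prod.distrib)
    also have "\<dots> = (\<Prod>i\<in>J. \<integral>\<^sup>+x. f i x * indicator (A i) x \<partial>M i)"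
      using J A by (intro product_nn_integral_prod) auto
    also have "\<dots> = (\<Prod>i\<in>J. emeasure (density (M i) (f i)) (A i))"
      using A by (intro prod.cong refl emeasure_density[symmetric]) auto
    finally show "emeasure (density (PiM J M) (\<lambda>x. \<Prod>i\<in>J. f i (x i))) (Pi\<^sub>E J A)
        = (\<Prod>i\<in>J. emeasure (density (M i) (f i)) (A i))" .
  qed (simp_all add: J sets)
qed

text \<open>
  For an infinite index set the product of the new marginals need not have a density with respect to
  the product of the old ones. On cylinders over a finite index set \<open>J\<close> only the
  marginals in \<open>J\<close> count: the factors outside \<open>J\<close> integrate to one under both laws.
\<close>

lemma (in product_prob_space) emeasure_PiM_density_cylinder:
  fixes f :: "'i \<Rightarrow> 'a \<Rightarrow> ennreal"
  assumes J: "finite J" "J \<subseteq> I" and B: "B \<in> sets (PiM J M)"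
    and f [measurable]: "\<And>i. f i \<in> borel_measurable (M i)"
    and prob: "\<And>i. prob_space (density (M i) (f i))"
  shows "emeasure (PiM I (\<lambda>i. density (M i) (f i))) (prod_emb I M J B)
       = emeasure (density (PiM I M) (\<lambda>\<omega>. \<Prod>i\<in>J. f i (\<omega> i))) (prod_emb I M J B)"
proof -
  interpret D: product_prob_space "\<lambda>i. density (M i) (f i)" I
    by (intro product_prob_spaceI prob)
  note [measurable] = B
  have sets: "sets (PiM J (\<lambda>i. density (M i) (f i))) = sets (PiM J M)"
    by (rule sets_PiM_cong) auto
  have emb: "prod_emb I (\<lambda>i. density (M i) (f i)) J B = prod_emb I M J B"
    by (simp add: prod_emb_def)
  have meas: "(\<lambda>x. \<Prod>i\<in>J. f i (x i)) \<in> borel_measurable (PiM J M)"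
    by simp
  have measI: "(\<lambda>x. \<Prod>i\<in>J. f i (x i)) \<in> borel_measurable (PiM I M)"
    using J by (intro borel_measurable_prod_ennreal measurable_compose[OF _ f]
                 measurable_component_singleton) auto
  have "emeasure (PiM I (\<lambda>i. density (M i) (f i))) (prod_emb I M J B)
      = emeasure (PiM J (\<lambda>i. density (M i) (f i))) B"
    using D.emeasure_PiM_emb'[OF J(2,1), of B] B by (simp add: sets emb)
  also have "\<dots> = (\<integral>\<^sup>+x. (\<Prod>i\<in>J. f i (x i)) * indicator B x \<partial>PiM J M)"
    using meas B by (simp add: PiM_density[OF J(1) f prob] emeasure_density)
  also have "\<dots> = (\<integral>\<^sup>+x. (\<Prod>i\<in>J. f i (x i)) * indicator B x
                     \<partial>distr (PiM I M) (PiM J M) (\<lambda>\<omega>. restrict \<omega> J))"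
    by (simp add: distr_PiM_restrict_finite[OF J])
  also have "\<dots> = (\<integral>\<^sup>+\<omega>. (\<Prod>i\<in>J. f i (restrict \<omega> J i)) * indicator B (restrict \<omega> J) \<partial>PiM I M)"
    using meas J(2) by (intro nn_integral_distr measurable_restrict_subset) auto
  also have "\<dots> = (\<integral>\<^sup>+\<omega>. (\<Prod>i\<in>J. f i (\<omega> i)) * indicator (prod_emb I M J B) \<omega> \<partial>PiM I M)"
    by (intro nn_integral_cong arg_cong2[where f="(*)"] prod.cong)
       (auto simp: prod_emb_def space_PiM indicator_def)
  also have "\<dots> = emeasure (density (PiM I M) (\<lambda>\<omega>. \<Prod>i\<in>J. f i (\<omega> i))) (prod_emb I M J B)"
    using J B measI by (intro emeasure_density[symmetric] measurable_prod_emb) auto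
  finally show ?thesis .
qed

section \<open>Events determined by the first coordinates\<close>

lemma space_past [simp]: "space (past n) = \<Omega>"
  unfolding past_def by (rule space_measure_of) auto

lemma subalgebra_past: "subalgebra seq_borel (past n)"
proof -
  have "sets (past n) \<subseteq> sets seq_borel"
    unfolding past_def sets_seq_borel by (subst sets_measure_of) (auto intro!: sigma_sets_mono')
  then show ?thesis by (simp add: subalgebra_def)
qed

text \<open>
  The \<open>\<sigma>\<close>-algebra generated by the coordinates \<open>1, \<dots>, n\<close> is contained in the preimage of the product
  \<open>\<sigma>\<close>-algebra under the projection to these coordinates, and every set of a preimage
  \<open>\<sigma>\<close>-algebra is itself a preimage. This makes cylinders out of all past events, not only out of
  the generating ones.
\<close>

lemma sets_past_cylinderE:
  assumes "A \<in> sets (past n)"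
  obtains B where "B \<in> sets (PiM {1..n} (\<lambda>_. borel))"
    and "A = prod_emb {1..} (\<lambda>_. borel) {1..n} B"
proof -
  let ?r = "\<lambda>\<omega> :: nat \<Rightarrow> real. restrict \<omega> {1..n}"
  let ?N = "PiM {1..n} (\<lambda>_. borel :: real measure)"
  let ?V = "vimage_algebra \<Omega> ?r ?N"
  have r: "?r \<in> \<Omega> \<rightarrow> space ?N"
    by (auto simp: space_PiM)
  have "{Z i -` A \<inter> \<Omega> | i A. i \<in> {1..n} \<and> A \<in> sets borel} \<subseteq> sets ?V"
  proof clarify
    fix i and A :: "real set" assume i: "i \<in> {1..n}" and A: "A \<in> sets borel"
    have "Z i -` A \<inter> \<Omega> = ?r -` {x \<in> space ?N. x i \<in> A} \<inter> \<Omega>"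
      using i by (auto simp: Z_def space_PiM)
    also have "\<dots> \<in> sets ?V"
      using i A by (intro in_vimage_algebra sets_Collect_single') auto
    finally show "Z i -` A \<inter> \<Omega> \<in> sets ?V" .
  qed
  then have "sets (past n) \<subseteq> sets ?V"
    unfolding past_def using sets.sigma_sets_subset[of _ ?V]
    by (subst sets_measure_of) auto
  with assms have "A \<in> sets ?V"
    by (rule subsetD[rotated])
  then obtain B where "B \<in> sets ?N" "A = ?r -` B \<inter> \<Omega>"
    unfolding sets_vimage_algebra2[OF r] by (elim CollectE exE conjE)
  moreover have "?r -` B \<inter> \<Omega> = prod_emb {1..} (\<lambda>_. borel) {1..n} B"
    by (simp add: prod_emb_def seq_borel_def space_PiM)
  ultimately show thesis
    using that by simp
qed

section \<open>The likelihood ratio of the tilted law\<close>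

lemma tilted_zero:
  assumes "real_distribution M"
  shows "tilted M 0 = M"
proof -
  interpret real_distribution M by fact
  have "prob UNIV = 1"
    using prob_space by simp
  then show ?thesis
    using tilted_eq_density(3)[OF assms, of 0] by (simp add: density_1)
qed

lemma exp_moment_pos:
  assumes "real_distribution M" "integrable M (\<lambda>z. exp (w * z))"
  shows "0 < (LINT z|M. exp (w * z))"
proof -
  interpret real_distribution M by fact
  have "(LINT z|M. exp (w * z)) \<noteq> 0"
    using integral_nonneg_eq_0_iff_AE[OF assms(2)] by (simp add: AE_False)
  moreover have "0 \<le> (LINT z|M. exp (w * z))"
    by simp
  ultimately show ?thesis by linarith
qed

lemma tilted_prob_zero:
  assumes "\<And>i. 1 \<le> i \<Longrightarrow> real_distribution (F i)"
  shows "tilted_prob F 0 = PiM {1..} F"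
  unfolding tilted_prob_def using assms by (intro PiM_cong) (auto simp: tilted_zero)

lemma expectation_coordinate:
  assumes F: "\<And>i. 1 \<le> i \<Longrightarrow> real_distribution (F i)" and i: "1 \<le> i"
  shows "(LINT \<omega>|tilted_prob F 0. exp (w * Z i \<omega>)) = (LINT z|F i. exp (w * z))"
proof -
  have prob: "prob_space (F j)" and sets: "sets (F j) = sets borel" if "1 \<le> j" for j
    using F[OF that] by (auto simp: real_distribution_def real_distribution_axioms_def)
  have "(LINT z|F i. exp (w * z)) = (LINT z|distr (PiM {1..} F) (F i) (\<lambda>\<omega>. \<omega> i). exp (w * z))"
    using i prob by (subst distr_PiM_component) auto
  also have "\<dots> = (LINT \<omega>|PiM {1..} F. exp (w * \<omega> i))"
    using i by (intro integral_distr) (auto simp: measurable_cong_sets[OF sets refl])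
  finally show ?thesis
    by (simp add: tilted_prob_zero[OF F] Z_def)
qed

lemma emeasure_tilted_prob_past:
  fixes F :: "nat \<Rightarrow> real measure"
  assumes F: "\<And>i. 1 \<le> i \<Longrightarrow> real_distribution (F i)"
    and int: "\<And>i. 1 \<le> i \<Longrightarrow> integrable (F i) (\<lambda>z. exp (w * z))"
    and A: "A \<in> sets (past n)"
  shows "emeasure (tilted_prob F w) A
       = emeasure (density (tilted_prob F 0)
           (\<lambda>\<omega>. \<Prod>i=1..n. exp (w * Z i \<omega>) / (LINT z|F i. exp (w * z)))) A"
proof -
  (* The facts on product probability spaces ask for a probability measure at every index,
     including the index 0, where F is arbitrary and which no coordinate uses. *)
  define G where "G i = F (max 1 i)" for i
  define f where "f i z = exp (w * z) / (LINT z|G i. exp (w * z))" for i z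
  have G: "real_distribution (G i)" and intG: "integrable (G i) (\<lambda>z. exp (w * z))" for i
    using F int by (auto simp: G_def)
  have GF: "G i = F i" if "1 \<le> i" for i using that by (simp add: G_def max_def)
  have sets: "sets (G i) = sets borel" for i
    using G[of i] by (simp add: real_distribution_def real_distribution_axioms_def)
  interpret product_prob_space G "{1..}"
    using G by (intro product_prob_spaceI) (simp add: real_distribution_def)
  have meas: "(\<lambda>z. ennreal (f i z)) \<in> borel_measurable (G i)" for i
    unfolding measurable_cong_sets[OF sets refl] f_def by measurable
  have tilt: "tilted (G i) w = density (G i) (\<lambda>z. ennreal (f i z))" for i
    using tilted_eq_density(3)[OF G intG] by (simp add: f_def)
  have prob: "prob_space (density (G i) (\<lambda>z. ennreal (f i z)))" for i
    using tilted_eq_density(1)[OF G intG] by (simp add: tilt real_distribution_def)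
  have f_nonneg: "0 \<le> f i z" for i z
    by (simp add: f_def)
  obtain B where B: "B \<in> sets (PiM {1..n} (\<lambda>_. borel))"
      "A = prod_emb {1..} (\<lambda>_. borel) {1..n} B"
    using A by (rule sets_past_cylinderE)
  have B': "B \<in> sets (PiM {1..n} G)"
    using B(1) sets_PiM_cong[OF refl, of "{1..n}" G "\<lambda>_. borel"] by (simp add: sets)
  have A': "A = prod_emb {1..} G {1..n} B"
    using sets_eq_imp_space_eq[OF sets] by (simp add: B(2) prod_emb_def)
  have "tilted_prob F w = PiM {1..} (\<lambda>i. density (G i) (\<lambda>z. ennreal (f i z)))"
    unfolding tilted_prob_def tilt[symmetric] by (intro PiM_cong) (auto simp: GF)
  moreover have "tilted_prob F 0 = PiM {1..} G"
    by (subst tilted_prob_zero[OF F]) (auto intro!: PiM_cong simp: GF)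
  moreover have "emeasure (PiM {1..} (\<lambda>i. density (G i) (\<lambda>z. ennreal (f i z)))) A
      = emeasure (density (PiM {1..} G) (\<lambda>\<omega>. \<Prod>i=1..n. ennreal (f i (\<omega> i)))) A"
    unfolding A' using B' meas prob by (intro emeasure_PiM_density_cylinder) auto
  moreover have "(\<Prod>i=1..n. ennreal (f i (\<omega> i)))
      = ennreal (\<Prod>i=1..n. exp (w * Z i \<omega>) / (LINT z|F i. exp (w * z)))" for \<omega>
    using f_nonneg by (subst prod_ennreal) (auto simp: f_def Z_def GF intro!: arg_cong[where f=ennreal] prod.cong)
  ultimately show ?thesis by simp
qed

text \<open>
  The change of measure in the form that the stopped identity uses: the normalising constants of the
  density are moved to the tilted side, where they become the product of the exponential moments.
\<close>

lemma integral_tilted_prob_past: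
  fixes F :: "nat \<Rightarrow> real measure"
  assumes F: "\<And>i. 1 \<le> i \<Longrightarrow> real_distribution (F i)"
    and int: "\<And>i. 1 \<le> i \<Longrightarrow> integrable (F i) (\<lambda>z. exp (w * z))"
    and g: "g \<in> borel_measurable (past n)"
  shows "(LINT \<omega>|tilted_prob F w. g \<omega> * (\<Prod>i=1..n. LINT \<omega>'|tilted_prob F 0. exp (w * Z i \<omega>')))
       = (LINT \<omega>|tilted_prob F 0. g \<omega> * exp (w * (\<Sum>i=1..n. Z i \<omega>)))"
proof -
  let ?c = "\<lambda>i. LINT z|F i. exp (w * z)"
  let ?L = "\<lambda>\<omega>. \<Prod>i=1..n. exp (w * Z i \<omega>) / ?c i"
  let ?D = "density (tilted_prob F 0) (\<lambda>\<omega>. ennreal (?L \<omega>))"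
  let ?C = "\<Prod>i=1..n. ?c i"
  have sub: "subalgebra M (past n)" if "sets M = sets seq_borel" for M
    using subalgebra_past[of n] sets_eq_imp_space_eq[OF that] that by (simp add: subalgebra_def)
  have subw: "subalgebra (tilted_prob F w) (past n)" and sub0: "subalgebra (tilted_prob F 0) (past n)"
    and subD: "subalgebra ?D (past n)"
    by (intro sub; simp add: sets_tilted_prob)+
  have restr: "restr_to_subalg (tilted_prob F w) (past n) = restr_to_subalg ?D (past n)"
  proof (rule measure_eqI)
    fix A assume "A \<in> sets (restr_to_subalg (tilted_prob F w) (past n))"
    then have A: "A \<in> sets (past n)" by (simp only: sets_restr_to_subalg[OF subw])
    show "emeasure (restr_to_subalg (tilted_prob F w) (past n)) A
        = emeasure (restr_to_subalg ?D (past n)) A"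
      unfolding emeasure_restr_to_subalg[OF subw A] emeasure_restr_to_subalg[OF subD A]
      by (rule emeasure_tilted_prob_past[OF F int A])
  qed (simp only: sets_restr_to_subalg[OF subw] sets_restr_to_subalg[OF subD])
  have gC: "(\<lambda>\<omega>. g \<omega> * ?C) \<in> borel_measurable (past n)"
    using g by simp
  have L: "?L \<in> borel_measurable (tilted_prob F 0)"
  proof -
    have "Z i \<in> borel_measurable seq_borel" if "1 \<le> i" for i
      unfolding Z_def seq_borel_def using that by (intro measurable_component_singleton) simp
    then show ?thesis
      unfolding measurable_cong_sets[OF sets_tilted_prob refl]
      by (intro borel_measurable_prod) auto
  qed
  have LC: "?L \<omega> * ?C = exp (w * (\<Sum>i=1..n. Z i \<omega>))" for \<omega>
  proof -
    have "?c i \<noteq> 0" if "1 \<le> i" for i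
      using exp_moment_pos[OF F int, of i] that by simp
    then have "?L \<omega> * ?C = (\<Prod>i=1..n. exp (w * Z i \<omega>))"
      by (subst prod.distrib[symmetric]) (auto intro!: prod.cong)
    then show ?thesis by (simp add: exp_sum sum_distrib_left)
  qed
  have "(\<Prod>i=1..n. LINT \<omega>'|tilted_prob F 0. exp (w * Z i \<omega>')) = ?C"
    by (intro prod.cong expectation_coordinate F) auto
  then have "(LINT \<omega>|tilted_prob F w. g \<omega> * (\<Prod>i=1..n. LINT \<omega>'|tilted_prob F 0. exp (w * Z i \<omega>')))
      = (LINT \<omega>|tilted_prob F w. g \<omega> * ?C)"
    by simp
  also have "\<dots> = (LINT \<omega>|?D. g \<omega> * ?C)"
    using integral_subalgebra2[OF subD gC]
    unfolding integral_subalgebra2[OF subw gC, symmetric] restr .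
  also have "\<dots> = (LINT \<omega>|tilted_prob F 0. ?L \<omega> *\<^sub>R (g \<omega> * ?C))"
    using L measurable_from_subalg[OF sub0 gC]
    by (intro integral_density) (auto intro!: prod_nonneg divide_nonneg_nonneg AE_I2)
  also have "\<dots> = (LINT \<omega>|tilted_prob F 0. g \<omega> * exp (w * (\<Sum>i=1..n. Z i \<omega>)))"
    unfolding LC[symmetric] by (simp only: real_scaleR_def ac_simps)
  finally show ?thesis .
qed

section \<open>The stopped identity\<close>

text \<open>
  Dominated convergence over the disjoint events \<open>T = 1, T = 2, \<dots>\<close>; the index is shifted to \<open>Suc n\<close>
  because a stopping time is at least one.
\<close>

lemma integral_stopped_sums:
  fixes X :: "(nat \<Rightarrow> real) \<Rightarrow> real"
  assumes T: "is_stopping_time T" and M: "sets M = sets seq_borel"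
    and int: "integrable M (\<lambda>\<omega>. X \<omega> * indicator {\<omega> \<in> \<Omega>. T \<omega> < \<infinity>} \<omega>)"
  shows "(LINT \<omega>|M. X \<omega> * indicator {\<omega> \<in> \<Omega>. T \<omega> < \<infinity>} \<omega>)
       = (\<Sum>n. LINT \<omega>|M. X \<omega> * indicator {\<omega> \<in> \<Omega>. T \<omega> = enat (Suc n)} \<omega>)"
proof -
  let ?A = "\<lambda>n. {\<omega> \<in> \<Omega>. T \<omega> = enat (Suc n)}"
  have U: "{\<omega> \<in> \<Omega>. T \<omega> < \<infinity>} = (\<Union>n. ?A n)"
  proof -
    have "\<exists>n. T \<omega> = enat (Suc n)" if fin: "\<omega> \<in> \<Omega>" "T \<omega> < \<infinity>" for \<omega>
    proof -
      obtain m where m: "T \<omega> = enat m" using fin(2) by (cases "T \<omega>") auto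
      moreover have "1 \<le> T \<omega>" using T fin(1) by (simp add: is_stopping_time_def)
      ultimately show ?thesis by (cases m) (auto simp: one_enat_def)
    qed
    then show ?thesis by auto
  qed
  have "?A n \<in> sets M" for n
    using T subalgebra_past[of "Suc n"] by (auto simp: is_stopping_time_def subalgebra_def M)
  moreover have "?A i \<inter> ?A j = {}" if "i \<noteq> j" for i j
    using that by auto
  moreover have "set_integrable M (\<Union>n. ?A n) X"
    using int by (simp add: set_integrable_def U[symmetric] mult.commute)
  ultimately have "(LINT \<omega>:(\<Union>n. ?A n)|M. X \<omega>) = (\<Sum>n. LINT \<omega>:?A n|M. X \<omega>)"
    by (intro lebesgue_integral_countable_add) auto
  then show ?thesis
    by (simp add: set_lebesgue_integral_def U[symmetric] mult.commute)
qed

theorem theorem1: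
  fixes F :: "nat \<Rightarrow> real measure"
    and W :: "real set"
    and T :: "(nat \<Rightarrow> real) \<Rightarrow> enat"
    and Y :: "(nat \<Rightarrow> real) \<Rightarrow> real"
    and w :: real
  assumes "\<And>i. 1 \<le> i \<Longrightarrow> real_distribution (F i)"
    and "is_interval W" and "0 \<in> W"
    and "\<And>i u. 1 \<le> i \<Longrightarrow> u \<in> W \<Longrightarrow> integrable (F i) (\<lambda>z. exp (u * z))"
    and "is_stopping_time T"
    and "Y \<in> borel_measurable seq_borel"
    and "\<And>n. 1 \<le> n \<Longrightarrow>
           (\<lambda>\<omega>. Y \<omega> * indicator {\<omega> \<in> \<Omega>. T \<omega> = enat n} \<omega>) \<in> borel_measurable (past n)"
    and "w \<in> W"
    and "integrable (tilted_prob F 0)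
           (\<lambda>\<omega>. Y \<omega> * exp (w * stopped_sum T \<omega>) * indicator {\<omega> \<in> \<Omega>. T \<omega> < \<infinity>} \<omega>)"
    and "integrable (tilted_prob F w)
           (\<lambda>\<omega>. Y \<omega> * (\<Prod>i=1..the_enat (T \<omega>). LINT \<omega>'|tilted_prob F 0. exp (w * Z i \<omega>'))
                  * indicator {\<omega> \<in> \<Omega>. T \<omega> < \<infinity>} \<omega>)"
  shows "(LINT \<omega>|tilted_prob F 0.
             Y \<omega> * exp (w * stopped_sum T \<omega>) * indicator {\<omega> \<in> \<Omega>. T \<omega> < \<infinity>} \<omega>)
       = (LINT \<omega>|tilted_prob F w.
             Y \<omega> * (\<Prod>i=1..the_enat (T \<omega>). LINT \<omega>'|tilted_prob F 0. exp (w * Z i \<omega>'))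
                  * indicator {\<omega> \<in> \<Omega>. T \<omega> < \<infinity>} \<omega>)"
proof -
  note F = assms(1) and int = assms(4)[OF _ assms(8)]
  let ?c = "\<lambda>i. LINT \<omega>'|tilted_prob F 0. exp (w * Z i \<omega>')"
  let ?I = "\<lambda>n. indicator {\<omega> \<in> \<Omega>. T \<omega> = enat n} :: _ \<Rightarrow> real"
  have slice: "(LINT \<omega>|tilted_prob F 0. Y \<omega> * exp (w * stopped_sum T \<omega>) * ?I n \<omega>)
      = (LINT \<omega>|tilted_prob F w. Y \<omega> * (\<Prod>i=1..the_enat (T \<omega>). ?c i) * ?I n \<omega>)"
    if "1 \<le> n" for n
  proof -
    have "(LINT \<omega>|tilted_prob F 0. Y \<omega> * exp (w * stopped_sum T \<omega>) * ?I n \<omega>)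
        = (LINT \<omega>|tilted_prob F 0. (Y \<omega> * ?I n \<omega>) * exp (w * (\<Sum>i=1..n. Z i \<omega>)))"
      by (intro Bochner_Integration.integral_cong) (auto simp: indicator_def stopped_sum_def)
    also have "\<dots> = (LINT \<omega>|tilted_prob F w. (Y \<omega> * ?I n \<omega>) * (\<Prod>i=1..n. ?c i))"
      by (rule integral_tilted_prob_past[OF F int assms(7)[OF that], symmetric])
    also have "\<dots> = (LINT \<omega>|tilted_prob F w. Y \<omega> * (\<Prod>i=1..the_enat (T \<omega>). ?c i) * ?I n \<omega>)"
      by (intro Bochner_Integration.integral_cong) (auto simp: indicator_def)
    finally show ?thesis .
  qed
  show ?thesis
    unfolding integral_stopped_sums[OF assms(5) sets_tilted_prob assms(9)]
      integral_stopped_sums[OF assms(5) sets_tilted_prob assms(10)]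
    by (intro arg_cong[where f=suminf] ext slice) simp
qed

end
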